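(* Let $\boldsymbol n\in\mathbb N_0^p$, $\boldsymbol m\in\mathbb N_0^q$ with $|\boldsymbol m|=|\boldsymbol n|+1$ and $\boldsymbol m$ near the diagonal, let the parameters be regular and admissible, let $\nu\ne0$, and let $B^{(j)}_{\boldsymbol n,\boldsymbol m}$, $\pi_{H,K}$ be as in the context. Let $j\in\{1,\dots,q\}$. If $m_j=0$ then $B^{(j)}_{\boldsymbol n,\boldsymbol m}\equiv0$. If $m_j\ge1$ then $$B^{(j)}_{\boldsymbol n,\boldsymbol m}(z)=\nu\Big(\pi_{j,0}\,\mathcal K_j(z)+\sum_{H\ne j,\ m_H\ge2}\mathcal C_{j,H}\,\mathcal K_{j,H}(z)\Big),$$ where $$\mathcal K_j(z)=F^{p+q:1;r}_{p+r:0;q-1}\left[\begin{matrix}1-m_j,\ \boldsymbol\kappa+(b_j+1)\mathbf 1_p+\boldsymbol n,\ b_j\mathbf 1_{q-1}-\boldsymbol b^{*j}+\mathbf 1_{q-1}-\boldsymbol m^{*j}\ :\ 1\ ;\ b_j\mathbf 1_r-\boldsymbol a\\ \boldsymbol\kappa+(b_j+1)\mathbf 1_p,\ b_j\mathbf 1_r-\boldsymbol a+\mathbf 1_r\ :\ \text{---}\ ;\ b_j\mathbf 1_{q-1}-\boldsymbol b^{*j}\end{matrix}\,\middle|\,(-1)^{q-r}z,\,1\right],$$ and, for $H\ne j$ with $m_H\ge2$, $$\mathcal C_{j,H}=\pi_{H,1}\frac{(\boldsymbol a-b_j\mathbf 1_r)_1}{(\boldsymbol b^{*j}-b_j\mathbf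 1_{q-1})_1}\,\frac{(\boldsymbol b^{*j}-(b_H+1)\mathbf 1_{q-1})_1}{(\boldsymbol a-(b_H+1)\mathbf 1_r)_1},$$ $$\mathcal K_{j,H}(z)=F^{p+q:1;r}_{p+r:0;q-1}\left[\begin{matrix}2-m_H,\ \boldsymbol\kappa+(b_H+2)\mathbf 1_p+\boldsymbol n,\ b_H\mathbf 1_{q-1}-\boldsymbol b^{*H}+2\mathbf 1_{q-1}-\boldsymbol m^{*H}\ :\ 1\ ;\ b_H\mathbf 1_r-\boldsymbol a+\mathbf 1_r\\ \boldsymbol\kappa+(b_H+2)\mathbf 1_p,\ b_H\mathbf 1_r-\boldsymbol a+2\mathbf 1_r\ :\ \text{---}\ ;\ b_H\mathbf 1_{q-1}-\boldsymbol b^{*H}+\mathbf 1_{q-1}+\boldsymbol e_j^{*H}\end{matrix}\,\middle|\,(-1)^{q-r}z,\,1\right].$$ The parameter $1-m_j$ makes the series $\mathcal K_j$ terminate on $u+\lambda\le m_j-1$, and $2-m_H$ makes $\mathcal K_{j,H}$ terminate on $u+\lambda\le m_H-2$, where $u,\lambda$ are the two summation indices.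
   Context: Notation. $\mathbf 1_d$: all-ones vector; $\boldsymbol e_j$: standard basis vector of $\mathbb C^q$; $|\boldsymbol n|=\sum n_i$; $\boldsymbol c^{*i}$: the vector $\boldsymbol c$ with its $i$-th component removed (so $\boldsymbol e_j^{*H}$ is $\boldsymbol e_j$ with its $H$-th component deleted). $(x)_n=\Gamma(x+n)/\Gamma(x)$; for vectors $(\boldsymbol c)_{\boldsymbol m}=\prod_h(c_h)_{m_h}$, and a scalar subscript is applied to each component; empty products are $1$. ${}_sF_t(\boldsymbol\alpha;\boldsymbol\beta;z)=\sum_k\frac{(\boldsymbol\alpha)_k}{(\boldsymbol\beta)_k}\frac{z^k}{k!}$. Kampé de Fériet series: for finite parameter strings, $$F\left[\begin{matrix}\boldsymbol A:\boldsymbol B;\boldsymbol C\\ \boldsymbol D:\boldsymbol E;\boldsymbol F\end{matrix}\middle|x,y\right]=\sum_{u,\lambda\ge0}\frac{(\boldsymbol A)_{u+\lambda}(\boldsymbol B)_u(\boldsymbol C)_\lambda}{(\boldsymbol D)_{u+\lambda}(\boldsymbol E)_u(\boldsymbol F)_\lambda}\frac{x^u}{u!}\frac{y^\lambda}{\lambda!},$$ with empty strings (—) contributing $1$; the super/subscripts on $F$ record the string lengths. Parameters: $p,q\ge1$, $0\le r<q$, $\boldsymbol a\in\mathbb C^r$, $\boldsymbol b\in\mathbb C^q$, $\boldsymbol\kappa\in\mathbb C^p$. Regular: $b_j-b_h\notin\mathbb Z$ $(j\ne h)$, $\kappa_i-\kappa_h\notin\mathbb Z$ $(i\ne h)$.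 Near the diagonal: $|m_j-m_h|\le1$ for all $j,h$. Admissible (all Gamma factors in the formulas, including those defining parameter-dependent Pochhammer quotients, finite): with $\mathbb Z_{\le0}=\{0,-1,\dots\}$, for all $i,j,\rho$: $\kappa_i+a_\rho+1\notin\mathbb Z_{\le0}$, $\kappa_i+b_j+1\notin\mathbb Z_{\le0}$; and $a_\rho-b_j-m_j+1\notin\mathbb Z_{\le0}$ whenever $m_j\ge1$. $B$-components: for $1\le H\le q$, $0\le K\le m_H-1$, $$\pi_{H,K}=-\frac{\prod_{i=1}^p(\kappa_i+b_H+K+1)_{n_i}}{(-1)^KK!\,(m_H-K-1)!\prod_{I\ne H}(b_I-b_H-K)_{m_I}};$$ $B^{(j)}_{\boldsymbol n,\boldsymbol m}\equiv0$ if $m_j=0$, and if $m_j\ge1$ $$B^{(j)}_{\boldsymbol n,\boldsymbol m}(z)=\nu\Bigg[\pi_{j,0}+\frac{(\boldsymbol a-b_j\mathbf 1_r)_1}{(\boldsymbol b^{*j}-b_j\mathbf 1_{q-1})_1}\sum_{H=1}^q\sum_{K=1}^{m_H-1}\pi_{H,K}\frac{(\boldsymbol b^{*j}-(b_H+K)\mathbf 1_{q-1})_1}{(\boldsymbol a-(b_H+K)\mathbf 1_r)_1}\;{}_{q+1}F_r\!\left(\begin{matrix}1,\ \boldsymbol b-(b_H+K)\mathbf 1_q+\mathbf 1_q-\boldsymbol e_j\\ \boldsymbol a-(b_H+K)\mathbf 1_r+\mathbf 1_r\end{matrix};z\right)\Bigg],$$ where the hypergeometric series terminates (its $H$-th numerator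 parameter is $1-K-\delta_{j,H}$) and is summed over $0\le d\le K-1+\delta_{j,H}$. *)

theory Defs
  imports "HOL-Analysis.Analysis"
begin

text \<open>
  A vector of length \<open>d\<close> is a function on \<open>nat\<close>, of which only the values at \<open>1, \<dots>, d\<close> are used;
  a parameter string of a hypergeometric series is a list. \<open>indices d\<close> and \<open>indices_but d H\<close> index
  a vector and that vector with its \<open>H\<close>-th component removed.
\<close>

abbreviation indices :: "nat \<Rightarrow> nat list" where
  "indices d \<equiv> [1..<Suc d]"

abbreviation indices_but :: "nat \<Rightarrow> nat \<Rightarrow> nat list" where
  "indices_but d H \<equiv> filter (\<lambda>I. I \<noteq> H) [1..<Suc d]"

definition unit_vec :: "nat \<Rightarrow> nat \<Rightarrow> complex" where
  "unit_vec j = (\<lambda>I. if I = j then 1 else 0)"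

definition regular :: "nat \<Rightarrow> nat \<Rightarrow> (nat \<Rightarrow> complex) \<Rightarrow> (nat \<Rightarrow> complex) \<Rightarrow> bool" where
  "regular p q b \<kappa> \<longleftrightarrow>
     (\<forall>j\<in>{1..q}. \<forall>h\<in>{1..q}. j \<noteq> h \<longrightarrow> b j - b h \<notin> \<int>) \<and>
     (\<forall>i\<in>{1..p}. \<forall>h\<in>{1..p}. i \<noteq> h \<longrightarrow> \<kappa> i - \<kappa> h \<notin> \<int>)"

definition near_diagonal :: "nat \<Rightarrow> (nat \<Rightarrow> nat) \<Rightarrow> bool" where
  "near_diagonal q m \<longleftrightarrow> (\<forall>j\<in>{1..q}. \<forall>h\<in>{1..q}. \<bar>int (m j) - int (m h)\<bar> \<le> 1)"

definition admissible ::
  "nat \<Rightarrow> nat \<Rightarrow> nat \<Rightarrow> (nat \<Rightarrow> complex) \<Rightarrow> (nat \<Rightarrow> complex) \<Rightarrow> (nat \<Rightarrow> complex) \<Rightarrow> (nat \<Rightarrow> nat) \<Rightarrow> bool"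
where
  "admissible p q r a b \<kappa> m \<longleftrightarrow>
     (\<forall>i\<in>{1..p}. \<forall>\<rho>\<in>{1..r}. \<kappa> i + a \<rho> + 1 \<notin> \<int>\<^sub>\<le>\<^sub>0) \<and>
     (\<forall>i\<in>{1..p}. \<forall>j\<in>{1..q}. \<kappa> i + b j + 1 \<notin> \<int>\<^sub>\<le>\<^sub>0) \<and>
     (\<forall>\<rho>\<in>{1..r}. \<forall>j\<in>{1..q}. m j \<ge> 1 \<longrightarrow> a \<rho> - b j - of_nat (m j) + 1 \<notin> \<int>\<^sub>\<le>\<^sub>0)"

definition poch_list :: "complex list \<Rightarrow> nat \<Rightarrow> complex" where
  "poch_list cs k = (\<Prod>c\<leftarrow>cs. pochhammer c k)"

definition hypergeo :: "complex list \<Rightarrow> complex list \<Rightarrow> complex \<Rightarrow> complex" where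
  "hypergeo \<alpha>s \<beta>s z = eval_fps (fps_hypergeo \<alpha>s \<beta>s 1) z"

lemma hypergeo_altdef:
  "hypergeo \<alpha>s \<beta>s z = (\<Sum>k. poch_list \<alpha>s k / poch_list \<beta>s k * z ^ k / fact k)"
proof -
  have *: "foldl (\<lambda>r x. r * pochhammer x k) c cs = c * poch_list cs k"
    for c :: complex and cs :: "complex list" and k
    by (induction cs arbitrary: c) (simp_all add: poch_list_def mult.assoc)
  show ?thesis
    by (simp add: hypergeo_def eval_fps_def * field_simps)
qed

text \<open>
  The Kampe de Feriet series. Whenever it terminates through an upper parameter, the terms beyond the
  truncation index are \<open>0\<close>, also where a lower Pochhammer symbol vanishes (as \<open>x / 0 = 0\<close>).
\<close>

definition kampe_term ::
  "complex list \<Rightarrow> complex list \<Rightarrow> complex list \<Rightarrow> complex list \<Rightarrow> complex list \<Rightarrow> complex list \<Rightarrow>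
   complex \<Rightarrow> complex \<Rightarrow> nat \<Rightarrow> nat \<Rightarrow> complex"
where
  "kampe_term A B C D E F x y u l =
     (poch_list A (u + l) * poch_list B u * poch_list C l) /
     (poch_list D (u + l) * poch_list E u * poch_list F l) * (x ^ u / fact u) * (y ^ l / fact l)"

definition kampe ::
  "complex list \<Rightarrow> complex list \<Rightarrow> complex list \<Rightarrow> complex list \<Rightarrow> complex list \<Rightarrow> complex list \<Rightarrow>
   complex \<Rightarrow> complex \<Rightarrow> complex"
where
  "kampe A B C D E F x y = (\<Sum>\<^sub>\<infinity>(u, l)\<in>UNIV. kampe_term A B C D E F x y u l)"

text \<open>The arguments are meant in the range \<open>1 \<le> H \<le> q\<close>, \<open>K < m H\<close>.\<close>

definition pi_coeff ::
  "nat \<Rightarrow> nat \<Rightarrow> (nat \<Rightarrow> complex) \<Rightarrow> (nat \<Rightarrow> complex) \<Rightarrow> (nat \<Rightarrow> nat) \<Rightarrow> (nat \<Rightarrow> nat) \<Rightarrow>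
   nat \<Rightarrow> nat \<Rightarrow> complex"
where
  "pi_coeff p q b \<kappa> n m H K =
     - ((\<Prod>i=1..p. pochhammer (\<kappa> i + b H + of_nat K + 1) (n i)) /
        ((-1) ^ K * fact K * fact (m H - K - 1) *
         (\<Prod>I\<in>{1..q}-{H}. pochhammer (b I - b H - of_nat K) (m I))))"

text \<open>
  The hypergeometric series below terminates: its numerator parameter with index \<open>I = H\<close> is
  \<open>1 - K\<close>, or \<open>- K\<close> if \<open>H = j\<close>. A Pochhammer symbol of a vector with scalar subscript \<open>1\<close>
  is written as the product of the components.
\<close>

definition B_comp ::
  "nat \<Rightarrow> nat \<Rightarrow> nat \<Rightarrow> (nat \<Rightarrow> complex) \<Rightarrow> (nat \<Rightarrow> complex) \<Rightarrow> (nat \<Rightarrow> complex) \<Rightarrow> complex \<Rightarrow>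
   (nat \<Rightarrow> nat) \<Rightarrow> (nat \<Rightarrow> nat) \<Rightarrow> nat \<Rightarrow> complex \<Rightarrow> complex"
where
  "B_comp p q r a b \<kappa> \<nu> n m j z =
     (if m j = 0 then 0
      else \<nu> * (pi_coeff p q b \<kappa> n m j 0 +
        (\<Prod>\<rho>=1..r. a \<rho> - b j) / (\<Prod>I\<in>{1..q}-{j}. b I - b j) *
        (\<Sum>H=1..q. \<Sum>K=1..m H - 1.
           pi_coeff p q b \<kappa> n m H K *
           ((\<Prod>I\<in>{1..q}-{j}. b I - (b H + of_nat K)) / (\<Prod>\<rho>=1..r. a \<rho> - (b H + of_nat K))) *
           hypergeo
             (1 # map (\<lambda>I. b I - (b H + of_nat K) + 1 - unit_vec j I) (indices q))
             (map (\<lambda>\<rho>. a \<rho> - (b H + of_nat K) + 1) (indices r))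
             z)))"

definition K_upper ::
  "nat \<Rightarrow> nat \<Rightarrow> (nat \<Rightarrow> complex) \<Rightarrow> (nat \<Rightarrow> complex) \<Rightarrow> (nat \<Rightarrow> nat) \<Rightarrow> (nat \<Rightarrow> nat) \<Rightarrow>
   nat \<Rightarrow> complex list"
where
  "K_upper p q b \<kappa> n m j =
     [1 - of_nat (m j)] @
     map (\<lambda>i. \<kappa> i + (b j + 1) + of_nat (n i)) (indices p) @
     map (\<lambda>I. b j - b I + 1 - of_nat (m I)) (indices_but q j)"

definition K_fun ::
  "nat \<Rightarrow> nat \<Rightarrow> nat \<Rightarrow> (nat \<Rightarrow> complex) \<Rightarrow> (nat \<Rightarrow> complex) \<Rightarrow> (nat \<Rightarrow> complex) \<Rightarrow>
   (nat \<Rightarrow> nat) \<Rightarrow> (nat \<Rightarrow> nat) \<Rightarrow> nat \<Rightarrow> complex \<Rightarrow> complex"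
where
  "K_fun p q r a b \<kappa> n m j z =
     kampe (K_upper p q b \<kappa> n m j)
       [1]
       (map (\<lambda>\<rho>. b j - a \<rho>) (indices r))
       (map (\<lambda>i. \<kappa> i + (b j + 1)) (indices p) @ map (\<lambda>\<rho>. b j - a \<rho> + 1) (indices r))
       []
       (map (\<lambda>I. b j - b I) (indices_but q j))
       ((-1) ^ (q - r) * z) 1"

definition C_coeff ::
  "nat \<Rightarrow> nat \<Rightarrow> nat \<Rightarrow> (nat \<Rightarrow> complex) \<Rightarrow> (nat \<Rightarrow> complex) \<Rightarrow> (nat \<Rightarrow> complex) \<Rightarrow>
   (nat \<Rightarrow> nat) \<Rightarrow> (nat \<Rightarrow> nat) \<Rightarrow> nat \<Rightarrow> nat \<Rightarrow> complex"
where
  "C_coeff p q r a b \<kappa> n m j H =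
     pi_coeff p q b \<kappa> n m H 1 *
     ((\<Prod>\<rho>=1..r. a \<rho> - b j) / (\<Prod>I\<in>{1..q}-{j}. b I - b j)) *
     ((\<Prod>I\<in>{1..q}-{j}. b I - (b H + 1)) / (\<Prod>\<rho>=1..r. a \<rho> - (b H + 1)))"

definition KH_upper ::
  "nat \<Rightarrow> nat \<Rightarrow> (nat \<Rightarrow> complex) \<Rightarrow> (nat \<Rightarrow> complex) \<Rightarrow> (nat \<Rightarrow> nat) \<Rightarrow> (nat \<Rightarrow> nat) \<Rightarrow>
   nat \<Rightarrow> complex list"
where
  "KH_upper p q b \<kappa> n m H =
     [2 - of_nat (m H)] @
     map (\<lambda>i. \<kappa> i + (b H + 2) + of_nat (n i)) (indices p) @
     map (\<lambda>I. b H - b I + 2 - of_nat (m I)) (indices_but q H)"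

definition KH_fun ::
  "nat \<Rightarrow> nat \<Rightarrow> nat \<Rightarrow> (nat \<Rightarrow> complex) \<Rightarrow> (nat \<Rightarrow> complex) \<Rightarrow> (nat \<Rightarrow> complex) \<Rightarrow>
   (nat \<Rightarrow> nat) \<Rightarrow> (nat \<Rightarrow> nat) \<Rightarrow> nat \<Rightarrow> nat \<Rightarrow> complex \<Rightarrow> complex"
where
  "KH_fun p q r a b \<kappa> n m j H z =
     kampe (KH_upper p q b \<kappa> n m H)
       [1]
       (map (\<lambda>\<rho>. b H - a \<rho> + 1) (indices r))
       (map (\<lambda>i. \<kappa> i + (b H + 2)) (indices p) @ map (\<lambda>\<rho>. b H - a \<rho> + 2) (indices r))
       []
       (map (\<lambda>I. b H - b I + 1 + unit_vec j I) (indices_but q H))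
       ((-1) ^ (q - r) * z) 1"

end

theory Submission
  imports Defs
begin

text \<open>
  Let \<open>k = 0\<close> for \<open>H = j\<close> and \<open>k = 1\<close> otherwise. The isolated term \<open>\<pi>\<^sub>j\<^sub>,\<^sub>0\<close> of \<open>B\<^sup>(\<^sup>j\<^sup>)\<close> is the missing
  summand \<open>H = j\<close>, \<open>K = 0\<close>, so that for every \<open>H\<close> the index \<open>K\<close> starts at \<open>k\<close> and the summation
  index \<open>d\<close> of the hypergeometric polynomial runs up to \<open>K - k\<close>. Putting \<open>u = d\<close> and
  \<open>\<lambda> = K - k - d\<close>, the part of the double sum that belongs to \<open>H\<close> is, term by term, its summand at
  \<open>K = k\<close>, \<open>d = 0\<close> times one Kampe de Feriet series: the reflection \<open>(1 - x - n)\<^sub>n = (-1)\<^sup>n (x)\<^sub>n\<close>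
  turns the descending Pochhammer symbols into ascending ones, which then cancel.
\<close>

section \<open>Shifts and reflections of Pochhammer symbols\<close>

lemma pochhammer_shift_ratio:
  fixes x :: "'a :: field_char_0"
  assumes "pochhammer x s \<noteq> 0"
  shows "pochhammer (x + of_nat s) n =
    pochhammer x n * (pochhammer (x + of_nat n) s / pochhammer x s)"
proof -
  \<comment> \<open>Both sides are \<open>pochhammer x (s + n)\<close>, split after \<open>s\<close>
    and after \<open>n\<close> factors.\<close>
  have "pochhammer x s * pochhammer (x + of_nat s) n = pochhammer x n * pochhammer (x + of_nat n) s"
    using pochhammer_product'[of x s n] pochhammer_product'[of x n s] by (simp add: add.commute)
  with assms show ?thesis
    by (simp add: field_simps)
qed

lemma pochhammer_reflect:
  "pochhammer (1 - x - of_nat k) k = (-1) ^ k * pochhammer (x :: 'a :: field_char_0) k"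
  using pochhammer_minus'[of "- x" k] by (simp add: algebra_simps)

text \<open>Up to sign, the factors are those of \<open>(s + k)! / k!\<close>. This converts both
  the factorial of \<open>m H - K - 1\<close> and the numerator parameter that makes the
  hypergeometric series terminate.\<close>

lemma pochhammer_neg_of_nat:
  "pochhammer (- of_nat (s + k)) s = ((-1) ^ s * fact (s + k) / fact k :: 'a :: field_char_0)"
proof -
  have "pochhammer (- of_nat (s + k)) s = (-1) ^ s * pochhammer (1 + of_nat k :: 'a) s"
    using pochhammer_reflect[of "1 + of_nat k :: 'a" s] by (simp add: algebra_simps)
  moreover have "fact (k + s) = (fact k * pochhammer (1 + of_nat k) s :: 'a)"
    using pochhammer_product'[of "1 :: 'a" k s] by (simp add: pochhammer_fact)
  ultimately show ?thesis
    by (simp add: add.commute)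
qed

text \<open>With \<open>s = u + l\<close>, splitting \<open>pochhammer (- x - s) (s + n)\<close> in
  two ways and reflecting evaluates the denominator. The numerator reflects to the last
  \<open>u\<close> factors of \<open>pochhammer (1 + x) s\<close>, so that the first
  \<open>l\<close> factors remain. The case \<open>u = 0\<close> gives the reciprocal of a single
  descending symbol.\<close>

lemma pochhammer_down_ratio:
  fixes x :: "'a :: field_char_0"
  assumes "pochhammer (1 + x) (u + l) \<noteq> 0" "pochhammer (- x - of_nat (u + l)) n \<noteq> 0"
    "pochhammer (- x) n \<noteq> 0"
  shows "pochhammer (- x - of_nat (u + l)) u / pochhammer (- x - of_nat (u + l)) n =
    (-1) ^ u / pochhammer (- x) n *
      (pochhammer (1 + x - of_nat n) (u + l) / pochhammer (1 + x) l)"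
proof -
  define s where "s = u + l"
  have "pochhammer (- x - of_nat s) s * pochhammer (- x) n =
      pochhammer (- x - of_nat s) n * pochhammer (- x - of_nat s + of_nat n) s"
    using pochhammer_product'[of "- x - of_nat s" s n]
      pochhammer_product'[of "- x - of_nat s" n s] by (simp add: add.commute)
  moreover have "pochhammer (- x - of_nat s) s = (-1) ^ s * pochhammer (1 + x) s"
    using pochhammer_reflect[of "1 + x" s] by simp
  moreover have "pochhammer (- x - of_nat s + of_nat n) s =
      (-1) ^ s * pochhammer (1 + x - of_nat n) s"
    using pochhammer_reflect[of "1 + x - of_nat n" s] by (simp add: algebra_simps)
  ultimately have eq: "pochhammer (1 + x) s * pochhammer (- x) n =
      pochhammer (- x - of_nat s) n * pochhammer (1 + x - of_nat n) s"
    by (auto simp: algebra_simps)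
  have "pochhammer (- x - of_nat s) u = (-1) ^ u * pochhammer (1 + x + of_nat l) u"
    using pochhammer_reflect[of "1 + x + of_nat l" u] by (simp add: s_def algebra_simps)
  moreover have "pochhammer (1 + x) s = pochhammer (1 + x) l * pochhammer (1 + x + of_nat l) u"
    using pochhammer_product'[of "1 + x" l u] by (simp add: s_def add.commute)
  ultimately show ?thesis
    using eq assms unfolding s_def [symmetric] by (simp add: divide_simps) (simp add: ac_simps)
qed

text \<open>With \<open>s = u + l\<close>, the Pochhammer symbol on the left reflects to the last
  \<open>u\<close> factors of \<open>pochhammer x s\<close>. The linear factor, up to sign, extends
  \<open>pochhammer x s\<close> to \<open>pochhammer x (s + 1)\<close>, which is
  \<open>x * pochhammer (1 + x) s\<close>.\<close>

lemma pochhammer_down_linear_ratio: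
  fixes x :: "'a :: field_char_0"
  assumes "pochhammer x (Suc (u + l)) \<noteq> 0"
  shows "(- x - of_nat (u + l)) * pochhammer (1 - x - of_nat (u + l)) u =
    (-1) ^ u * (- x) * (pochhammer (1 + x) (u + l) / pochhammer x l)"
proof -
  have 1: "pochhammer (1 - x - of_nat (u + l)) u = (-1) ^ u * pochhammer (x + of_nat l) u"
    using pochhammer_reflect[of "x + of_nat l" u] by (simp add: algebra_simps)
  have 2: "pochhammer x (u + l) = pochhammer x l * pochhammer (x + of_nat l) u"
    using pochhammer_product'[of x l u] by (simp add: add.commute)
  have 3: "x * pochhammer (1 + x) (u + l) = (x + of_nat (u + l)) * pochhammer x (u + l)"
    using pochhammer_rec[of x "u + l"] pochhammer_rec'[of x "u + l"] by (simp add: add.commute)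
  have "pochhammer x (u + l) \<noteq> 0"
    using assms pochhammer_neq_0_mono by fastforce
  hence 4: "pochhammer x l \<noteq> 0"
    using 2 by auto
  \<comment> \<open>Expanding by \<open>pochhammer x l\<close> completes the last \<open>u\<close>
    factors to the full \<open>pochhammer x (u + l)\<close>.\<close>
  hence "(- x - y) * P = - ((x + y) * (pochhammer x l * P)) / pochhammer x l" for y P
    by (simp add: field_simps)
  from this[of "of_nat (u + l)" "pochhammer (x + of_nat l) u"] show ?thesis
    unfolding 2 [symmetric] 3 [symmetric] 1
    by (simp add: mult.left_commute[of _ "(-1) ^ u"] mult.assoc)
qed

section \<open>Pochhammer symbols of parameter strings as products over index sets\<close>

lemma poch_list_map:
  assumes "distinct xs"
  shows "poch_list (map f xs) k = (\<Prod>x\<in>set xs. pochhammer (f x) k)"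
  using prod.distinct_set_conv_list[OF assms, of "\<lambda>x. pochhammer (f x) k"]
  by (simp add: poch_list_def o_def)

lemma poch_list_simps [simp]:
  "poch_list cs 0 = 1"
  "poch_list [] k = 1"
  "poch_list (x # xs) k = pochhammer x k * poch_list xs k"
  "poch_list (xs @ ys) k = poch_list xs k * poch_list ys k"
  by (induction cs) (simp_all add: poch_list_def)

lemma poch_list_indices:
  "poch_list (map f (indices d)) k = (\<Prod>i=1..d. pochhammer (f i) k)"
  by (subst poch_list_map) (auto simp del: upt_Suc simp: atLeastLessThanSuc_atLeastAtMost intro!: prod.cong)

lemma poch_list_indices_but:
  "poch_list (map f (indices_but d H)) k = (\<Prod>I\<in>{1..d}-{H}. pochhammer (f I) k)"
  by (subst poch_list_map) (auto simp del: upt_Suc simp: atLeastLessThanSuc_atLeastAtMost intro!: prod.cong)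


section \<open>Comparison of single terms\<close>

text \<open>Every factor at \<open>K = k + (u + l)\<close> is compared with its value at
  \<open>K = k\<close>. The offset \<open>c\<close> covers both series at once:
  \<open>c = b j\<close> gives the parameters of \<open>K_fun\<close>, and
  \<open>c = b H + 1\<close> those of \<open>KH_fun\<close>. The nonvanishing assumptions license
  the cancellations.\<close>

lemma summand_eq_kampe_term:
  fixes a b \<kappa> :: "nat \<Rightarrow> complex" and n m :: "nat \<Rightarrow> nat" and p q r j H u l :: nat
  defines "k \<equiv> (if H = j then 0 else 1 :: nat)"
  defines "c \<equiv> b H + of_nat k"
  defines "lin \<equiv> \<lambda>K. (\<Prod>I\<in>{1..q}-{j}. b I - (b H + of_nat K)) / (\<Prod>\<rho>=1..r. a \<rho> - (b H + of_nat K))"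
  assumes "j \<in> {1..q}" "H \<in> {1..q}" "r < q" "k + (u + l) < m H"
    and \<kappa>: "\<And>i. i \<in> {1..p} \<Longrightarrow> pochhammer (\<kappa> i + (c + 1)) (u + l) \<noteq> 0"
    and b: "\<And>I. I \<in> {1..q} - {H} \<Longrightarrow> b H - b I \<notin> \<int>"
    and a: "\<And>\<rho>. \<rho> \<in> {1..r} \<Longrightarrow> pochhammer (c - a \<rho>) (Suc (u + l)) \<noteq> 0"
  shows "pi_coeff p q b \<kappa> n m H (k + (u + l)) * lin (k + (u + l)) *
      (poch_list (1 # map (\<lambda>I. b I - (b H + of_nat (k + (u + l))) + 1 - unit_vec j I) (indices q)) u /
       poch_list (map (\<lambda>\<rho>. a \<rho> - (b H + of_nat (k + (u + l))) + 1) (indices r)) u * z ^ u / fact u) =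
    pi_coeff p q b \<kappa> n m H k * lin k *
      kampe_term
        ([of_nat (Suc k) - of_nat (m H)] @ map (\<lambda>i. \<kappa> i + (c + 1) + of_nat (n i)) (indices p) @
          map (\<lambda>I. c - b I + 1 - of_nat (m I)) (indices_but q H))
        [1]
        (map (\<lambda>\<rho>. c - a \<rho>) (indices r))
        (map (\<lambda>i. \<kappa> i + (c + 1)) (indices p) @ map (\<lambda>\<rho>. c - a \<rho> + 1) (indices r))
        []
        (map (\<lambda>I. c - b I + unit_vec j I) (indices_but q H))
        ((-1) ^ (q - r) * z) 1 u l"
proof -
  define s N where "s = u + l" and "N = m H - Suc k"
  have "s \<le> N" and mH: "m H = Suc (k + N)"
    using assms by (auto simp: s_def N_def)
  \<comment> \<open>The functions of \<open>t\<close> are the products in the coefficient at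
    \<open>K = k + t\<close>. \<open>PF\<close> and \<open>PA\<close> come from the hypergeometric
    term at \<open>K = k + s\<close>, where \<open>PF\<close> omits the component
    \<open>I = H\<close>. The other products are the strings of the Kampe de Feriet term.\<close>
  define PK where "PK = (\<lambda>t. \<Prod>i=1..p. pochhammer (\<kappa> i + b H + of_nat (k + t) + 1) (n i))"
  define PB where "PB = (\<lambda>t. \<Prod>I\<in>{1..q}-{H}. pochhammer (b I - b H - of_nat (k + t)) (m I))"
  define Q where "Q = (\<lambda>t. \<Prod>I\<in>{1..q}-{j}. b I - (b H + of_nat (k + t)))"
  define A where "A = (\<lambda>t. \<Prod>\<rho>=1..r. a \<rho> - (b H + of_nat (k + t)))"
  define PF where "PF = (\<Prod>I\<in>{1..q}-{H}. pochhammer (b I - (b H + of_nat (k + s)) + 1 - unit_vec j I) u)"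
  define PA where "PA = (\<Prod>\<rho>=1..r. pochhammer (a \<rho> - (b H + of_nat (k + s)) + 1) u)"
  define U1 D1 where "U1 = (\<Prod>i=1..p. pochhammer (\<kappa> i + (c + 1) + of_nat (n i)) s)"
    and "D1 = (\<Prod>i=1..p. pochhammer (\<kappa> i + (c + 1)) s)"
  define U2 F where "U2 = (\<Prod>I\<in>{1..q}-{H}. pochhammer (c - b I + 1 - of_nat (m I)) s)"
    and "F = (\<Prod>I\<in>{1..q}-{H}. pochhammer (c - b I + unit_vec j I) l)"
  define C D2 where "C = (\<Prod>\<rho>=1..r. pochhammer (c - a \<rho>) l)"
    and "D2 = (\<Prod>\<rho>=1..r. pochhammer (c - a \<rho> + 1) s)"

  have PK: "PK s = PK 0 * (U1 / D1)"
  proof -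
    have "PK s = (\<Prod>i=1..p. pochhammer (\<kappa> i + b H + of_nat (k + 0) + 1) (n i) *
        (pochhammer (\<kappa> i + (c + 1) + of_nat (n i)) s / pochhammer (\<kappa> i + (c + 1)) s))"
      unfolding PK_def
    proof (rule prod.cong)
      fix i assume "i \<in> {1..p}"
      from pochhammer_shift_ratio[OF \<kappa>[OF this], of "n i"]
      show "pochhammer (\<kappa> i + b H + of_nat (k + s) + 1) (n i) =
          pochhammer (\<kappa> i + b H + of_nat (k + 0) + 1) (n i) *
          (pochhammer (\<kappa> i + (c + 1) + of_nat (n i)) s / pochhammer (\<kappa> i + (c + 1)) s)"
        by (simp add: c_def s_def algebra_simps)
    qed auto
    then show ?thesis
      by (simp add: PK_def U1_def D1_def prod.distrib prod_dividef)
  qed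

  \<comment> \<open>The terminating upper parameter is \<open>- N\<close>. The sign
    \<open>(-1) ^ s\<close> cancels against the change of \<open>(-1) ^ K\<close> in
    \<open>pi_coeff\<close>.\<close>
  have sum_N: "1 / fact (N - s) = (-1) ^ s * pochhammer (of_nat (Suc k) - of_nat (m H)) s / (fact N :: complex)"
    using pochhammer_neg_of_nat[of s "N - s", where 'a = complex] \<open>s \<le> N\<close> by (simp add: mH)

  have A: "1 / (A s * PA) = 1 / A 0 * (-1) ^ (u * r) * (C / D2)"
  proof -
    have "1 / (A s * PA) = (\<Prod>\<rho>=1..r. 1 / ((a \<rho> - (b H + of_nat (k + s))) *
        pochhammer (a \<rho> - (b H + of_nat (k + s)) + 1) u))"
      by (simp add: A_def PA_def prod.distrib prod_dividef)
    also have "\<dots> = (\<Prod>\<rho>=1..r. 1 / (a \<rho> - (b H + of_nat (k + 0))) * (-1) ^ u *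
        (pochhammer (c - a \<rho>) l / pochhammer (c - a \<rho> + 1) s))"
    proof (rule prod.cong)
      fix \<rho> assume "\<rho> \<in> {1..r}"
      \<comment> \<open>The sign is its own inverse; zero factors are covered by
        \<open>1 / 0 = 0\<close>.\<close>
      have inv: "1 / ((-1) ^ u * x * (y / z)) = 1 / x * (-1) ^ u * (z / y)" for x y z :: complex
        by (cases "even u") simp_all
      have "(a \<rho> - (b H + of_nat (k + s))) * pochhammer (a \<rho> - (b H + of_nat (k + s)) + 1) u =
          (-1) ^ u * (a \<rho> - (b H + of_nat (k + 0))) * (pochhammer (c - a \<rho> + 1) s / pochhammer (c - a \<rho>) l)"
        using pochhammer_down_linear_ratio[OF a[OF \<open>\<rho> \<in> {1..r}\<close>]]
        by (simp add: c_def s_def algebra_simps)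
      then show "1 / ((a \<rho> - (b H + of_nat (k + s))) * pochhammer (a \<rho> - (b H + of_nat (k + s)) + 1) u) =
          1 / (a \<rho> - (b H + of_nat (k + 0))) * (-1) ^ u *
          (pochhammer (c - a \<rho>) l / pochhammer (c - a \<rho> + 1) s)"
        by (simp only: inv)
    qed auto
    also have "\<dots> = 1 / A 0 * (-1) ^ (u * r) * (C / D2)"
      by (simp add: A_def C_def D2_def prod.distrib prod_dividef power_mult)
    finally show ?thesis .
  qed

  \<comment> \<open>\<open>Q\<close> omits the index \<open>j\<close>, but \<open>PF\<close> and
    \<open>PB\<close> omit \<open>H\<close>. \<open>G\<close> carries the linear factors over to the
    latter index set, with a dummy factor 1 at \<open>I = j\<close>.\<close>
  define G where "G = (\<lambda>t. \<Prod>I\<in>{1..q}-{H}. if I = j then 1 else b I - (b H + of_nat (k + t)))"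
  \<comment> \<open>For \<open>H \<noteq> j\<close> the factor \<open>I = H\<close> of
    \<open>Q t\<close> is \<open>- (t + 1)\<close>, which reduces \<open>(t + 1)!\<close> to
    \<open>t!\<close>. The sign left over is the same for every \<open>t\<close>, hence absorbed
    when \<open>t = s\<close> is compared with \<open>t = 0\<close>.\<close>
  have Q: "Q t / fact (k + t) = (if H = j then 1 else - 1) * G t / fact t" for t
  proof (cases "H = j")
    case True
    then show ?thesis
      by (auto simp: Q_def G_def k_def intro!: prod.cong)
  next
    case False
    have "Q t = (b H - (b H + of_nat (k + t))) * (\<Prod>I\<in>{1..q}-{j}-{H}. b I - (b H + of_nat (k + t)))"
      unfolding Q_def using False \<open>H \<in> {1..q}\<close> by (subst prod.remove[of _ H]) auto
    moreover have "G t = (\<Prod>I\<in>{1..q}-{j}-{H}. b I - (b H + of_nat (k + t)))"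
      unfolding G_def using False \<open>j \<in> {1..q}\<close>
      by (subst prod.remove[of _ j]) (auto intro!: prod.cong)
    ultimately have "Q t = - of_nat (Suc t) * G t"
      using False by (simp add: k_def)
    then show ?thesis
      using False by (simp add: k_def field_simps del: of_nat_Suc)
  qed

  have G: "G s * (PF / PB s) = G 0 / PB 0 * (-1) ^ (u * (q - 1)) * (U2 / F)"
  proof -
    have "G s * (PF / PB s) = (\<Prod>I\<in>{1..q}-{H}. (if I = j then 1 else b I - (b H + of_nat (k + s))) *
        (pochhammer (b I - (b H + of_nat (k + s)) + 1 - unit_vec j I) u /
         pochhammer (b I - b H - of_nat (k + s)) (m I)))"
      by (simp add: G_def PF_def PB_def prod.distrib prod_dividef)
    also have "\<dots> = (\<Prod>I\<in>{1..q}-{H}. (if I = j then 1 else b I - (b H + of_nat (k + 0))) /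
        pochhammer (b I - b H - of_nat (k + 0)) (m I) * (-1) ^ u *
        (pochhammer (c - b I + 1 - of_nat (m I)) s / pochhammer (c - b I + unit_vec j I) l))"
    proof (rule prod.cong)
      fix I assume I: "I \<in> {1..q} - {H}"
      define x where "x = c - b I"
      \<comment> \<open>By regularity, \<open>x\<close> is not an integer, so no Pochhammer symbol
        at an integer translate of \<open>x\<close> or \<open>- x\<close> vanishes.\<close>
      have nonint: "x + of_int i \<noteq> 0" for i
      proof
        assume "x + of_int i = 0"
        hence "b H - b I = of_int (- i - int k)"
          by (simp add: x_def c_def algebra_simps)
        with b[OF I] show False
          by (metis Ints_of_int)
      qed
      have nz: "pochhammer (x + of_int i) t \<noteq> 0" "pochhammer (- x + of_int i) t \<noteq> 0" for i t
      proof -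
        have "x + of_int i \<noteq> - of_nat v" for v
          using nonint[of "i + int v"] by (simp add: eq_neg_iff_add_eq_0 add.assoc)
        moreover have "- x + of_int i \<noteq> - of_nat v" for v
        proof
          assume eq: "- x + of_int i = - of_nat v"
          have "x + of_int (- i - int v) = - ((- x + of_int i) + of_nat v)"
            by simp
          also have "\<dots> = 0"
            unfolding eq by simp
          finally show False
            using nonint by blast
        qed
        ultimately show "pochhammer (x + of_int i) t \<noteq> 0" "pochhammer (- x + of_int i) t \<noteq> 0"
          by (auto simp: pochhammer_eq_0_iff)
      qed
      have down: "pochhammer (- x - of_nat s) v / pochhammer (- x - of_nat s) (m I) =
          (-1) ^ v / pochhammer (- x) (m I) *
          (pochhammer (1 + x - of_nat (m I)) s / pochhammer (1 + x) (s - v))" if "v \<le> s" for v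
        using pochhammer_down_ratio[of x v "s - v" "m I"] nz(1)[of 1 s] nz(2)[of "- int s" "m I"]
          nz(2)[of 0 "m I"] that by (simp add: add.commute)
      \<comment> \<open>For \<open>I = j\<close> the unit vector removes the \<open>+ 1\<close> and
        there is no linear factor, so the lower parameter becomes \<open>x + 1\<close>. For
        \<open>I \<noteq> j\<close> the linear factor is present,
        \<open>pochhammer (1 + x) s\<close> cancels, and the lower parameter is
        \<open>x\<close>.\<close>
      have ratio: "(if I = j then 1 else - x - of_nat s) *
          (pochhammer (1 - x - of_nat s - unit_vec j I) u / pochhammer (- x - of_nat s) (m I)) =
          (if I = j then 1 else - x) / pochhammer (- x) (m I) * (-1) ^ u *
          (pochhammer (1 + x - of_nat (m I)) s / pochhammer (x + unit_vec j I) l)"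
      proof (cases "I = j")
        case True
        then show ?thesis
          using down[of u] by (simp add: unit_vec_def s_def add.commute algebra_simps)
      next
        case False
        have "(- x - of_nat s) * pochhammer (1 - x - of_nat s) u =
            (-1) ^ u * (- x) * (pochhammer (1 + x) s / pochhammer x l)"
          using pochhammer_down_linear_ratio[of x u l] nz(1)[of 0 "Suc (u + l)"] by (simp add: s_def)
        moreover have "1 / pochhammer (- x - of_nat s) (m I) =
            1 / pochhammer (- x) (m I) * (pochhammer (1 + x - of_nat (m I)) s / pochhammer (1 + x) s)"
          using down[of 0] by simp
        moreover have "pochhammer (1 + x) s \<noteq> 0"
          using nz(1)[of 1 s] by (simp add: add.commute)
        ultimately have "((- x - of_nat s) * pochhammer (1 - x - of_nat s) u) *
            (1 / pochhammer (- x - of_nat s) (m I)) =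
            (- x) / pochhammer (- x) (m I) * (-1) ^ u *
            (pochhammer (1 + x - of_nat (m I)) s / pochhammer x l)"
          by (simp only:) (simp add: mult_ac)
        with False show ?thesis
          by (simp add: unit_vec_def)
      qed
      have "b I - (b H + of_nat (k + s)) = - x - of_nat s" "b I - (b H + of_nat (k + 0)) = - x"
        "b I - b H - of_nat (k + s) = - x - of_nat s" "b I - b H - of_nat (k + 0) = - x"
        "- x - of_nat s + 1 - unit_vec j I = 1 - x - of_nat s - unit_vec j I"
        "c - b I = x" "x + 1 - of_nat (m I) = 1 + x - of_nat (m I)"
        by (simp_all add: x_def c_def)
      note eqs = this
      show "(if I = j then 1 else b I - (b H + of_nat (k + s))) *
          (pochhammer (b I - (b H + of_nat (k + s)) + 1 - unit_vec j I) u /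
           pochhammer (b I - b H - of_nat (k + s)) (m I)) =
          (if I = j then 1 else b I - (b H + of_nat (k + 0))) /
          pochhammer (b I - b H - of_nat (k + 0)) (m I) * (-1) ^ u *
          (pochhammer (c - b I + 1 - of_nat (m I)) s / pochhammer (c - b I + unit_vec j I) l)"
        unfolding eqs by (rule ratio)
    qed auto
    also have "\<dots> = G 0 / PB 0 * (-1) ^ (u * (q - 1)) * (U2 / F)"
      using \<open>H \<in> {1..q}\<close>
      by (simp add: G_def PB_def U2_def F_def prod.distrib prod_dividef power_mult)
    finally show ?thesis .
  qed

  have QG: "Q s / fact (k + s) * (PF / PB s) =
      Q 0 / fact k / PB 0 * (-1) ^ (u * (q - 1)) * (U2 / F) / fact s"
  proof -
    have "Q s / fact (k + s) * (PF / PB s) = (if H = j then 1 else - 1) * (G s * (PF / PB s)) / fact s"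
      by (simp only: Q) simp
    also have "\<dots> = (if H = j then 1 else - 1) * G 0 / fact 0 / PB 0 * (-1) ^ (u * (q - 1)) * (U2 / F) / fact s"
      by (simp only: G) simp
    finally show ?thesis
      using Q[of 0] by simp
  qed

  \<comment> \<open>The factor \<open>s!\<close> cancels against the one in \<open>QG\<close>, and
    \<open>1 / l!\<close> is the factorial of the second summation index.\<close>
  have PS: "pochhammer (- of_nat s) u = ((-1) ^ u * fact s / fact l :: complex)"
    using pochhammer_neg_of_nat[of u l] by (simp add: s_def)

  \<comment> \<open>The component \<open>I = H\<close> is \<open>- s\<close> in both cases, since
    \<open>k\<close> and \<open>unit_vec j H\<close> add up to 1.\<close>
  have F_H: "(\<Prod>I=1..q. pochhammer (b I - (b H + of_nat (k + s)) + 1 - unit_vec j I) u) =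
      pochhammer (- of_nat s) u * PF"
    unfolding PF_def using \<open>H \<in> {1..q}\<close>
    by (subst prod.remove[of _ H]) (auto simp: unit_vec_def k_def)

  \<comment> \<open>The signs come from the \<open>q - 1\<close> components
    \<open>I \<noteq> H\<close>, the \<open>r\<close> lower parameters and the component
    \<open>I = H\<close>. Their total exponent \<open>u * (q + r)\<close> has the parity of
    \<open>u * (q - r)\<close>.\<close>
  have sign: "(-1) ^ (u * (q - 1)) * (-1) ^ (u * r) * (-1) ^ u = (((-1) ^ (q - r)) ^ u :: complex)"
  proof -
    have "u * (q - 1) + u * r + u = (q - r) * u + 2 * (r * u)"
      using less_imp_Suc_add[OF \<open>r < q\<close>] by (auto simp: algebra_simps)
    hence "(-1) ^ (u * (q - 1)) * (-1) ^ (u * r) * (-1) ^ u = ((-1) ^ ((q - r) * u + 2 * (r * u)) :: complex)"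
      by (simp only: power_add [symmetric])
    then show ?thesis
      by (simp add: power_add power_mult)
  qed

  have pi: "pi_coeff p q b \<kappa> n m H (k + t) =
      - (PK t / ((-1) ^ (k + t) * fact (k + t) * fact (N - t) * PB t))" if "t \<le> N" for t
    by (simp add: pi_coeff_def PK_def PB_def mH)
  have lin: "lin (k + t) = Q t / A t" for t
    by (simp add: lin_def Q_def A_def)
  have "pi_coeff p q b \<kappa> n m H (k + s) * lin (k + s) *
      (poch_list (1 # map (\<lambda>I. b I - (b H + of_nat (k + s)) + 1 - unit_vec j I) (indices q)) u /
       poch_list (map (\<lambda>\<rho>. a \<rho> - (b H + of_nat (k + s)) + 1) (indices r)) u * z ^ u / fact u) =
      - (PK s / ((-1) ^ (k + s) * fact (k + s) * fact (N - s) * PB s)) * (Q s / A s) *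
      (pochhammer 1 u * (pochhammer (- of_nat s) u * PF) / PA * z ^ u / fact u)"
    unfolding pi[OF \<open>s \<le> N\<close>] lin poch_list_simps poch_list_indices F_H
    by (simp only: PA_def)
  \<comment> \<open>The factors are regrouped into the blocks evaluated above; this holds at zero
    factors too, as \<open>inverse\<close> is multiplicative everywhere.\<close>
  also have "\<dots> = - (PK s / (-1) ^ (k + s)) * (Q s / fact (k + s) * (PF / PB s)) * (1 / fact (N - s)) *
      (1 / (A s * PA)) * (pochhammer 1 u * pochhammer (- of_nat s) u * z ^ u / fact u)"
    by (simp only: divide_inverse inverse_mult_distrib mult_ac mult_minus_left mult_minus_right mult_1)
  also have "\<dots> = - (PK 0 / ((-1) ^ k * fact k * fact N * PB 0)) * (Q 0 / A 0) *
      ((pochhammer (of_nat (Suc k) - of_nat (m H)) s * (U1 * U2) * pochhammer 1 u * C) / (D1 * D2 * F) *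
       (((-1) ^ (u * (q - 1)) * (-1) ^ (u * r) * (-1) ^ u) * z ^ u / fact u) * (1 / fact l))"
    unfolding PK QG sum_N A PS by (simp add: divide_simps power_add)
  also have "\<dots> = pi_coeff p q b \<kappa> n m H k * lin k * 
      kampe_term
        ([of_nat (Suc k) - of_nat (m H)] @ map (\<lambda>i. \<kappa> i + (c + 1) + of_nat (n i)) (indices p) @
          map (\<lambda>I. c - b I + 1 - of_nat (m I)) (indices_but q H))
        [1]
        (map (\<lambda>\<rho>. c - a \<rho>) (indices r))
        (map (\<lambda>i. \<kappa> i + (c + 1)) (indices p) @ map (\<lambda>\<rho>. c - a \<rho> + 1) (indices r))
        []
        (map (\<lambda>I. c - b I + unit_vec j I) (indices_but q H))
        ((-1) ^ (q - r) * z) 1 u l"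
    unfolding sign kampe_term_def poch_list_simps poch_list_indices poch_list_indices_but
      s_def [symmetric] U1_def [symmetric] U2_def [symmetric] D1_def [symmetric] D2_def [symmetric]
      F_def [symmetric] C_def [symmetric]
    using pi[of 0] lin[of 0] by (simp add: power_mult_distrib)
  finally show ?thesis
    unfolding s_def .
qed


section \<open>Terminating series as finite sums\<close>

lemma poch_list_eq_0:
  assumes "- of_nat s \<in> set cs" "s < k"
  shows "poch_list cs k = 0"
  using assms by (force simp: poch_list_def prod_list_zero_iff pochhammer_of_nat_eq_0_iff)

lemma hypergeo_terminates:
  assumes "- of_nat s \<in> set \<alpha>s"
  shows "hypergeo \<alpha>s \<beta>s z = (\<Sum>k\<le>s. poch_list \<alpha>s k / poch_list \<beta>s k * z ^ k / fact k)"
  unfolding hypergeo_altdef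
  by (rule suminf_finite) (auto simp: poch_list_eq_0[OF assms])

text \<open>The terms vanish outside the triangle \<open>u + l \<le> s\<close>, which is summed
  along the antidiagonals \<open>u + l = t\<close>. In this order \<open>t\<close> matches
  \<open>K - k\<close> and \<open>u\<close> matches the hypergeometric index.\<close>

lemma kampe_terminates:
  assumes "- of_nat s \<in> set A"
  shows "kampe A B C D E F x y = (\<Sum>t\<le>s. \<Sum>u\<le>t. kampe_term A B C D E F x y u (t - u))"
proof -
  have zero: "kampe_term A B C D E F x y u l = 0" if "s < u + l" for u l
    using poch_list_eq_0[OF assms that] by (simp add: kampe_term_def)
  have "{(u, l). u + l < Suc s} \<subseteq> {..s} \<times> {..s}"
    by auto
  hence fin: "finite {(u, l). u + l < Suc s}"
    using finite_subset by blast
  have "kampe A B C D E F x y =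
      (\<Sum>\<^sub>\<infinity>(u, l)\<in>{(u, l). u + l < Suc s}. kampe_term A B C D E F x y u l)"
    unfolding kampe_def by (rule infsum_cong_neutral) (auto simp: zero)
  also have "\<dots> = (\<Sum>(u, l)\<in>{(u, l). u + l < Suc s}. kampe_term A B C D E F x y u l)"
    using fin by simp
  also have "\<dots> = (\<Sum>t<Suc s. \<Sum>u\<le>t. kampe_term A B C D E F x y u (t - u))"
    by (rule sum.triangle_reindex)
  finally show ?thesis
    by (simp only: lessThan_Suc_atMost)
qed

section \<open>The part of the double sum that belongs to one \<open>H\<close>\<close>

lemma sum_hypergeo_eq_kampe:
  fixes a b \<kappa> :: "nat \<Rightarrow> complex" and n m :: "nat \<Rightarrow> nat" and p q r j H :: nat
  defines "k \<equiv> (if H = j then 0 else 1 :: nat)"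
  defines "c \<equiv> b H + of_nat k"
  defines "lin \<equiv> \<lambda>K. (\<Prod>I\<in>{1..q}-{j}. b I - (b H + of_nat K)) / (\<Prod>\<rho>=1..r. a \<rho> - (b H + of_nat K))"
  assumes "j \<in> {1..q}" "H \<in> {1..q}" "r < q" "k < m H"
    and "regular p q b \<kappa>" "admissible p q r a b \<kappa> m"
  shows "(\<Sum>K=k..m H - 1. pi_coeff p q b \<kappa> n m H K * lin K *
      hypergeo (1 # map (\<lambda>I. b I - (b H + of_nat K) + 1 - unit_vec j I) (indices q))
        (map (\<lambda>\<rho>. a \<rho> - (b H + of_nat K) + 1) (indices r)) z) =
    pi_coeff p q b \<kappa> n m H k * lin k *
      kampe
        ([of_nat (Suc k) - of_nat (m H)] @ map (\<lambda>i. \<kappa> i + (c + 1) + of_nat (n i)) (indices p) @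
          map (\<lambda>I. c - b I + 1 - of_nat (m I)) (indices_but q H))
        [1]
        (map (\<lambda>\<rho>. c - a \<rho>) (indices r))
        (map (\<lambda>i. \<kappa> i + (c + 1)) (indices p) @ map (\<lambda>\<rho>. c - a \<rho> + 1) (indices r))
        []
        (map (\<lambda>I. c - b I + unit_vec j I) (indices_but q H))
        ((-1) ^ (q - r) * z) 1"
    (is "_ = _ * kampe ?A ?B ?C ?D ?E ?F ?x 1")
proof -
  define N where "N = m H - Suc k"
  have mH: "m H = Suc (k + N)"
    using \<open>k < m H\<close> by (simp add: N_def)
  define ht where "ht = (\<lambda>K d.
    poch_list (1 # map (\<lambda>I. b I - (b H + of_nat K) + 1 - unit_vec j I) (indices q)) d /
    poch_list (map (\<lambda>\<rho>. a \<rho> - (b H + of_nat K) + 1) (indices r)) d * z ^ d / fact d)"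
  \<comment> \<open>Lowering a nonpositive integer by \<open>k\<close> keeps it nonpositive, so a
    zero would contradict admissibility of \<open>\<kappa> i + b H + 1\<close>.\<close>
  have \<kappa>: "pochhammer (\<kappa> i + (c + 1)) t \<noteq> 0" if "i \<in> {1..p}" for i t
  proof
    assume "pochhammer (\<kappa> i + (c + 1)) t = 0"
    then obtain v where "\<kappa> i + (c + 1) = - of_nat v"
      by (auto simp: pochhammer_eq_0_iff)
    moreover have "\<kappa> i + b H + 1 = \<kappa> i + (c + 1) - of_nat k"
      by (simp add: c_def)
    ultimately have "\<kappa> i + b H + 1 = - of_nat (v + k)"
      by (simp only: of_nat_add minus_add_distrib diff_conv_add_uminus)
    hence "\<kappa> i + b H + 1 \<in> \<int>\<^sub>\<le>\<^sub>0"
      by (metis minus_of_nat_in_nonpos_Ints)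
    moreover have "\<kappa> i + b H + 1 \<notin> \<int>\<^sub>\<le>\<^sub>0"
      using assms that by (auto simp: admissible_def)
    ultimately show False
      by contradiction
  qed
  have b: "b H - b I \<notin> \<int>" if "I \<in> {1..q} - {H}" for I
    using assms that by (auto simp: regular_def)
  \<comment> \<open>A zero means \<open>a \<rho> = c + v\<close> with \<open>v \<le> N\<close>. As
    \<open>m H = k + N + 1\<close>, the quantity in the admissibility condition would then be
    \<open>- (N - v)\<close>; the bound on \<open>v\<close> makes it nonpositive.\<close>
  have a: "pochhammer (c - a \<rho>) (Suc t) \<noteq> 0" if "\<rho> \<in> {1..r}" "t \<le> N" for \<rho> t
  proof
    assume "pochhammer (c - a \<rho>) (Suc t) = 0"
    then obtain v where "v \<le> N" "c - a \<rho> = - of_nat v"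
      using \<open>t \<le> N\<close> by (auto simp: pochhammer_eq_0_iff)
    hence "a \<rho> - b H - of_nat (m H) + 1 = - of_nat (N - v)"
      by (simp add: c_def mH of_nat_diff algebra_simps)
    moreover have "a \<rho> - b H - of_nat (m H) + 1 \<notin> \<int>\<^sub>\<le>\<^sub>0"
      using assms(5,7,9) that(1) by (simp add: admissible_def)
    ultimately show False
      by simp
  qed
  \<comment> \<open>The numerator parameter with index \<open>H\<close> is
    \<open>- t\<close>.\<close>
  have hyper: "hypergeo (1 # map (\<lambda>I. b I - (b H + of_nat (k + t)) + 1 - unit_vec j I) (indices q))
      (map (\<lambda>\<rho>. a \<rho> - (b H + of_nat (k + t)) + 1) (indices r)) z = (\<Sum>d\<le>t. ht (k + t) d)" for t
    unfolding ht_def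
    by (rule hypergeo_terminates)
      (use \<open>H \<in> {1..q}\<close> in \<open>auto simp: k_def unit_vec_def image_iff simp del: upt_Suc intro!: bexI[of _ H]\<close>)
  have "(\<Sum>K=k..m H - 1. pi_coeff p q b \<kappa> n m H K * lin K *
      hypergeo (1 # map (\<lambda>I. b I - (b H + of_nat K) + 1 - unit_vec j I) (indices q))
        (map (\<lambda>\<rho>. a \<rho> - (b H + of_nat K) + 1) (indices r)) z) =
    (\<Sum>t\<le>N. pi_coeff p q b \<kappa> n m H (k + t) * lin (k + t) *
      hypergeo (1 # map (\<lambda>I. b I - (b H + of_nat (k + t)) + 1 - unit_vec j I) (indices q))
        (map (\<lambda>\<rho>. a \<rho> - (b H + of_nat (k + t)) + 1) (indices r)) z)"
    by (rule sum.reindex_bij_witness[of _ "\<lambda>t. k + t" "\<lambda>K. K - k"]) (auto simp: mH)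
  also have "\<dots> = (\<Sum>t\<le>N. \<Sum>d\<le>t. pi_coeff p q b \<kappa> n m H (k + t) * lin (k + t) * ht (k + t) d)"
    by (simp only: hyper sum_distrib_left)
  also have "\<dots> = (\<Sum>t\<le>N. \<Sum>d\<le>t. pi_coeff p q b \<kappa> n m H k * lin k *
      kampe_term ?A ?B ?C ?D ?E ?F ?x 1 d (t - d))"
  proof (intro sum.cong refl)
    fix t d assume "t \<in> {..N}" "d \<in> {..t}"
    hence eq: "d + (t - d) = t" and "t \<le> N"
      by auto
    show "pi_coeff p q b \<kappa> n m H (k + t) * lin (k + t) * ht (k + t) d =
        pi_coeff p q b \<kappa> n m H k * lin k * kampe_term ?A ?B ?C ?D ?E ?F ?x 1 d (t - d)"
      unfolding ht_def lin_def c_def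
      by (rule summand_eq_kampe_term[where u = d and l = "t - d" and H = H and j = j,
            folded k_def, unfolded eq])
        (use assms(4-7) \<kappa>[of _ t] b a[OF _ \<open>t \<le> N\<close>] \<open>t \<le> N\<close> mH in \<open>auto simp: c_def\<close>)
  qed
  also have "\<dots> = pi_coeff p q b \<kappa> n m H k * lin k * kampe ?A ?B ?C ?D ?E ?F ?x 1"
    by (subst kampe_terminates[of N]) (simp_all add: mH sum_distrib_left)
  finally show ?thesis .
qed

section \<open>Truncation of the two series and assembly of \<open>B_comp\<close>\<close>

lemma K_upper_eq_0:
  assumes "m j \<ge> 1" "u + l > m j - 1"
  shows "poch_list (K_upper p q b \<kappa> n m j) (u + l) = 0"
  using assms by (intro poch_list_eq_0[of "m j - 1"]) (auto simp: K_upper_def of_nat_diff)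

lemma KH_upper_eq_0:
  assumes "m H \<ge> 2" "u + l > m H - 2"
  shows "poch_list (KH_upper p q b \<kappa> n m H) (u + l) = 0"
  using assms by (intro poch_list_eq_0[of "m H - 2"]) (auto simp: KH_upper_def of_nat_diff)

theorem corollary4p4:
  fixes p q r j :: nat
    and a b \<kappa> :: "nat \<Rightarrow> complex"
    and n m :: "nat \<Rightarrow> nat"
    and \<nu> :: complex
  assumes "p \<ge> 1" and "q \<ge> 1" and "r < q"
    and "(\<Sum>h=1..q. m h) = (\<Sum>i=1..p. n i) + 1"
    and "near_diagonal q m"
    and "regular p q b \<kappa>"
    and "admissible p q r a b \<kappa> m"
    and "\<nu> \<noteq> 0"
    and "j \<in> {1..q}"
  shows "(m j = 0 \<longrightarrow> (\<forall>z. B_comp p q r a b \<kappa> \<nu> n m j z = 0)) \<and>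
    (m j \<ge> 1 \<longrightarrow>
      (\<forall>z. B_comp p q r a b \<kappa> \<nu> n m j z =
         \<nu> * (pi_coeff p q b \<kappa> n m j 0 * K_fun p q r a b \<kappa> n m j z +
           (\<Sum>H\<in>{H\<in>{1..q}. H \<noteq> j \<and> m H \<ge> 2}.
              C_coeff p q r a b \<kappa> n m j H * KH_fun p q r a b \<kappa> n m j H z))) \<and>
      (\<forall>u l. u + l > m j - 1 \<longrightarrow> poch_list (K_upper p q b \<kappa> n m j) (u + l) = 0) \<and>
      (\<forall>H\<in>{1..q}. H \<noteq> j \<and> m H \<ge> 2 \<longrightarrow>
        (\<forall>u l. u + l > m H - 2 \<longrightarrow> poch_list (KH_upper p q b \<kappa> n m H) (u + l) = 0)))"
proof (intro conjI impI allI ballI)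
  fix z assume "m j = 0"
  then show "B_comp p q r a b \<kappa> \<nu> n m j z = 0"
    by (simp add: B_comp_def)
next
  fix z assume mj: "m j \<ge> 1"
  define lin where "lin = (\<lambda>H K. (\<Prod>I\<in>{1..q}-{j}. b I - (b H + of_nat K)) /
    (\<Prod>\<rho>=1..r. a \<rho> - (b H + of_nat K)))"
  define hyp where "hyp = (\<lambda>H K.
    hypergeo (1 # map (\<lambda>I. b I - (b H + of_nat K) + 1 - unit_vec j I) (indices q))
      (map (\<lambda>\<rho>. a \<rho> - (b H + of_nat K) + 1) (indices r)) z)"
  define pref where "pref = (\<Prod>\<rho>=1..r. a \<rho> - b j) / (\<Prod>I\<in>{1..q}-{j}. b I - b j)"
  define S where "S = (\<lambda>H k. \<Sum>K=k..m H - 1. pi_coeff p q b \<kappa> n m H K * lin H K * hyp H K)"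

  \<comment> \<open>If \<open>a \<rho> = b j\<close>, the admissibility condition would fail with
    the value \<open>1 - m j\<close>, nonpositive because \<open>m j \<ge> 1\<close>.\<close>
  have "a \<rho> - b j \<noteq> 0" if "\<rho> \<in> {1..r}" for \<rho>
  proof
    assume "a \<rho> - b j = 0"
    hence "a \<rho> - b j - of_nat (m j) + 1 = - of_nat (m j - 1)"
      using mj by (simp add: of_nat_diff)
    moreover have "a \<rho> - b j - of_nat (m j) + 1 \<notin> \<int>\<^sub>\<le>\<^sub>0"
      using assms(7,9) mj that by (simp add: admissible_def)
    ultimately show False
      by simp
  qed
  moreover have "b I - b j \<noteq> 0" if "I \<in> {1..q} - {j}" for I
  proof -
    have "b I - b j \<notin> \<int>"
      using assms(6,9) that by (auto simp: regular_def)
    then show ?thesis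
      by auto
  qed
  \<comment> \<open>Together with \<open>hyp_0\<close> this identifies the isolated term of
    \<open>B_comp\<close> with the summand \<open>H = j\<close>, \<open>K = 0\<close>.\<close>
  ultimately have lin_0: "pref * lin j 0 = 1"
    by (simp add: pref_def lin_def)
  have hyp_0: "hyp j 0 = 1"
    unfolding hyp_def using \<open>j \<in> {1..q}\<close>
    by (subst hypergeo_terminates[of 0])
      (auto simp: unit_vec_def image_iff simp del: upt_Suc intro!: bexI[of _ j])

  have S_j: "S j 0 = pi_coeff p q b \<kappa> n m j 0 * lin j 0 * K_fun p q r a b \<kappa> n m j z"
  proof -
    \<comment> \<open>The unit vector vanishes away from the removed index \<open>j\<close>.\<close>
    have F: "map (\<lambda>I. b j - b I + unit_vec j I) (indices_but q j) =
        map (\<lambda>I. b j - b I) (indices_but q j)"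
      by (auto simp: unit_vec_def)
    show ?thesis
      using sum_hypergeo_eq_kampe[of j q j r m p b \<kappa> a n z] assms mj
      by (simp add: S_def lin_def hyp_def K_fun_def K_upper_def F
          del: upt_Suc map_eq_conv One_nat_def)
  qed
  have S_H: "S H 1 = pi_coeff p q b \<kappa> n m H 1 * lin H 1 * KH_fun p q r a b \<kappa> n m j H z"
    if "H \<in> {1..q}" "H \<noteq> j" "m H \<ge> 2" for H
  proof -
    show ?thesis
      using sum_hypergeo_eq_kampe[of j q H r m p b \<kappa> a n z] assms that
      by (simp add: S_def lin_def hyp_def KH_fun_def KH_upper_def algebra_simps del: upt_Suc)
  qed

  \<comment> \<open>The range of \<open>K\<close> is empty, also for \<open>m H = 0\<close>, where
    the truncated \<open>m H - 1\<close> is 0.\<close>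
  have S_0: "S H 1 = 0" if "m H < 2" for H
    unfolding S_def using that by (subst atLeastatMost_empty) auto
  have "(\<Sum>H=1..q. S H 1) = S j 1 + (\<Sum>H\<in>{1..q}-{j}. S H 1)"
    using \<open>j \<in> {1..q}\<close> by (simp add: sum.remove)
  also have "(\<Sum>H\<in>{1..q}-{j}. S H 1) = (\<Sum>H\<in>{H\<in>{1..q}. H \<noteq> j \<and> m H \<ge> 2}. S H 1)"
    by (rule sum.mono_neutral_right) (auto intro!: S_0[simplified] simp: not_le)
  finally have split: "(\<Sum>H=1..q. S H 1) = S j 1 + (\<Sum>H\<in>{H\<in>{1..q}. H \<noteq> j \<and> m H \<ge> 2}. S H 1)" .
  have "S j 0 = pi_coeff p q b \<kappa> n m j 0 * lin j 0 * hyp j 0 + S j 1"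
    unfolding S_def by (subst sum.atLeast_Suc_atMost) auto
  \<comment> \<open>The isolated term completes the sum for \<open>H = j\<close>, which now starts
    at \<open>K = 0\<close>.\<close>
  hence j_part: "pi_coeff p q b \<kappa> n m j 0 + pref * S j 1 = pref * S j 0"
    using lin_0 by (simp add: hyp_0 algebra_simps)

  have "B_comp p q r a b \<kappa> \<nu> n m j z = \<nu> * (pi_coeff p q b \<kappa> n m j 0 + pref * (\<Sum>H=1..q. S H 1))"
    using mj unfolding B_comp_def S_def pref_def lin_def hyp_def by simp
  also have "\<dots> = \<nu> * (pref * S j 0 + (\<Sum>H\<in>{H\<in>{1..q}. H \<noteq> j \<and> m H \<ge> 2}. pref * S H 1))"
    unfolding split j_part [symmetric] by (simp add: distrib_left sum_distrib_left)
  also have "pref * S j 0 = pi_coeff p q b \<kappa> n m j 0 * K_fun p q r a b \<kappa> n m j z"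
    using lin_0 by (simp add: S_j)
  also have "(\<Sum>H\<in>{H\<in>{1..q}. H \<noteq> j \<and> m H \<ge> 2}. pref * S H 1) =
      (\<Sum>H\<in>{H\<in>{1..q}. H \<noteq> j \<and> m H \<ge> 2}.
        C_coeff p q r a b \<kappa> n m j H * KH_fun p q r a b \<kappa> n m j H z)"
    by (intro sum.cong refl) (simp add: S_H[simplified] C_coeff_def pref_def lin_def)
  finally show "B_comp p q r a b \<kappa> \<nu> n m j z =
      \<nu> * (pi_coeff p q b \<kappa> n m j 0 * K_fun p q r a b \<kappa> n m j z +
        (\<Sum>H\<in>{H\<in>{1..q}. H \<noteq> j \<and> m H \<ge> 2}.
           C_coeff p q r a b \<kappa> n m j H * KH_fun p q r a b \<kappa> n m j H z))" .
qed (use K_upper_eq_0 KH_upper_eq_0 in auto)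

end
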